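(* Let $\mathcal A_1,\dots,\mathcal A_d\subset\mathbb Z^d$ be finite sets such that the Cayley configuration $C(\mathcal A_1,\dots,\mathcal A_d)$ contains a $(2d-1)$-simplex, let $\mathcal A=\bigcup_i\mathcal A_i=\{a_1,\dots,a_n\}$ and $C=(c_{ij})\in\mathbb R^{d\times n}$ with $c_{ij}=0$ whenever $a_j\notin\mathcal A_i$. Assume there exist $p$ mixed $(2d-1)$-simplices $\Delta_1,\dots,\Delta_p$ of $C(\mathcal A_1,\dots,\mathcal A_d)$ which are part of a (common) regular subdivision (for instance, when $p=2$ and the two simplices share a facet) and are positively decorated by $C$. Set $N=|\mathcal A_1|+\dots+|\mathcal A_d|$ and assume that the cone $\mathcal C_{\Delta_1,\dots,\Delta_p}\subset\mathbb R^N$ of all height vectors inducing regular subdivisions of $C(\mathcal A_1,\dots,\mathcal A_d)$ containing $\Delta_1,\dots,\Delta_p$ is \[ \mathcal C_{\Delta_1,\dots,\Delta_p}=\{h\in\mathbb R^N:\ \langle m_r,h\rangle>0,\ r=1,\dots,\ell\},\qquad m_r\in\mathbb R^N. \] Then for any $\varepsilon\in(0,1)^\ell$ there exists $t_0(\varepsilon)>0$ such that for any $\gamma$ in the set \[ U=\bigcup_{\varepsilon\in(0,1)^\ell}\{\gamma=(\gamma^1,\dots,\gamma^d)\in\mathbb R^N_{>0}:\ \gamma^{m_r}\le t_0(\varepsilon)^{\varepsilon_r},\ r=1,\dots,\ell\}, \] the system \[ \sum_{a_j\in\mathcal A_i}c_{ij}\,\gamma^i_j\,x^{a_j}=0,\qquad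 i=1,\dots,d, \] has at least $p$ nondegenerate solutions in $\mathbb R^d_{>0}$.
   Context: $e_1,\dots,e_d$ is the canonical basis of $\mathbb Z^d$; $C(\mathcal A_1,\dots,\mathcal A_d)=\bigcup_i(\mathcal A_i\times\{e_i\})\subset\mathbb Z^{2d}$, a set of $N$ points; height vectors in $\mathbb R^N$ have one coordinate for each point $(a_j,e_i)$, and $\gamma=(\gamma^1,\dots,\gamma^d)\in\mathbb R^N_{>0}$ is indexed the same way, where $\gamma^i$ has coordinates $\gamma^i_j$ for $a_j\in\mathcal A_i$; $\gamma^{m}$ denotes the product of the coordinates of $\gamma$ raised to the corresponding coordinates of $m$. A $(2d-1)$-simplex is a set of $2d$ affinely independent points of the configuration; it is mixed if it consists of exactly two points $(a_{j_1},e_i),(a_{j_2},e_i)$ for each $i$, and positively decorated by $C$ if $c_{i,j_1}c_{i,j_2}<0$ for each $i$. Regular subdivisions of a point configuration $P\subset\mathbb R^{2d}$: for $h:P\to\mathbb R$, lift $q\mapsto(q,h(q))$; lower faces of the convex hull of the lifted points are those with an inner normal of positive last coordinate; each lower face $F$ gives the cell $\{q:(q,h(q))\in F\}$; the cells form the regular subdivision induced by $h$; a simplex is part of it if it is a cell. Two simplices share a facet if the intersection of their convex hulls is a facet of both. A solution is nondegenerate if the Jacobian determinant of the system does not vanish at it. *)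

theory Defs
  imports "HOL-Analysis.Analysis"
begin

text \<open>Points of the Cayley configuration C(A_1,...,A_d) are represented as pairs (a,i)
  with a in A_i; they are embedded into R^d x R^d as (a, e_i).\<close>

definition cayley :: "('d::finite \<Rightarrow> (int^'d) set) \<Rightarrow> ((int^'d) \<times> 'd) set" where
  "cayley A = {(a, i). a \<in> A i}"

definition cay_emb :: "(int^'d::finite) \<times> 'd \<Rightarrow> (real^'d) \<times> (real^'d)" where
  "cay_emb q = ((\<chi> k. real_of_int (fst q $ k)), axis (snd q) 1)"

text \<open>A (2d-1)-simplex of the configuration: 2d affinely independent points.\<close>
definition cay_simplex :: "('d::finite \<Rightarrow> (int^'d) set) \<Rightarrow> ((int^'d) \<times> 'd) set \<Rightarrow> bool" where
  "cay_simplex A S \<longleftrightarrow> S \<subseteq> cayley A \<and> card S = 2 * CARD('d)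
      \<and> \<not> affine_dependent (cay_emb ` S)"

definition mixed_simplex :: "('d::finite \<Rightarrow> (int^'d) set) \<Rightarrow> ((int^'d) \<times> 'd) set \<Rightarrow> bool" where
  "mixed_simplex A S \<longleftrightarrow> cay_simplex A S \<and> (\<forall>i. card {a. (a, i) \<in> S} = 2)"

definition pos_decorated :: "((int^'d::finite) \<times> 'd \<Rightarrow> real) \<Rightarrow> ((int^'d) \<times> 'd) set \<Rightarrow> bool" where
  "pos_decorated c S \<longleftrightarrow>
     (\<forall>i a1 a2. (a1, i) \<in> S \<and> (a2, i) \<in> S \<and> a1 \<noteq> a2 \<longrightarrow> c (a1, i) * c (a2, i) < 0)"

text \<open>Lower faces of the convex hull of a lifted point set: faces with an inner normal
  (u,c) whose last coordinate c is positive, i.e. the minimisers of that functional.\<close>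
definition lower_face :: "('p::real_inner \<times> real) set \<Rightarrow> ('p \<times> real) set \<Rightarrow> bool" where
  "lower_face L F \<longleftrightarrow> (\<exists>u c. c > 0 \<and>
     F = {z \<in> convex hull L. \<forall>y \<in> convex hull L. inner (u, c) z \<le> inner (u, c) y})"

text \<open>Q is a cell of the regular subdivision of P induced by the heights h.\<close>
definition regular_cell :: "('q \<Rightarrow> 'p::real_inner) \<Rightarrow> 'q set \<Rightarrow> ('q \<Rightarrow> real) \<Rightarrow> 'q set \<Rightarrow> bool" where
  "regular_cell emb P h Q \<longleftrightarrow>
     (\<exists>F. lower_face ((\<lambda>q. (emb q, h q)) ` P) F \<and> Q = {q \<in> P. (emb q, h q) \<in> F})"

definition monom :: "real^'d::finite \<Rightarrow> int^'d \<Rightarrow> real" where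
  "monom x a = (\<Prod>k\<in>UNIV. (x $ k) powr real_of_int (a $ k))"

text \<open>The system  sum_{a in A_i} c_{i,a} gamma^i_a x^a = 0,  i = 1..d.\<close>
definition cay_system :: "('d::finite \<Rightarrow> (int^'d) set) \<Rightarrow> ((int^'d) \<times> 'd \<Rightarrow> real)
    \<Rightarrow> ((int^'d) \<times> 'd \<Rightarrow> real) \<Rightarrow> real^'d \<Rightarrow> real^'d" where
  "cay_system A c \<gamma> x = (\<chi> i. \<Sum>a\<in>A i. c (a, i) * \<gamma> (a, i) * monom x a)"

definition nondegenerate :: "(real^'n::finite \<Rightarrow> real^'n) \<Rightarrow> real^'n \<Rightarrow> bool" where
  "nondegenerate F x \<longleftrightarrow> (\<exists>F'. (F has_derivative F') (at x) \<and> det (matrix F') \<noteq> 0)"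

end

theory Submission
  imports Defs
begin

text \<open>Let the mixed simplex \<open>\<Delta>\<close> consist of the pairs \<open>a1(i), a2(i)\<close> in \<open>\<A>\<^sub>i\<close>. If the height
  \<open>-ln \<gamma>\<close> is affine on \<open>\<Delta>\<close> and lies above that affine function by a large gap at all other
  points, substitute \<open>x = exp (w + B\<^sup>-\<^sup>1 v)\<close>, where \<open>B\<close> has rows \<open>a2(i) - a1(i)\<close>: equation \<open>i\<close>
  divided by its \<open>a1(i)\<close>-term becomes \<open>c(a1(i)) + c(a2(i)) exp v\<^sub>i + (small)\<close>. The opposite signs
  of the two coefficients give a root of the unperturbed system, Brouwer's theorem a root of
  the perturbed one, and the Jacobian there is diagonally dominant, hence invertible. At this
  root the two terms of \<open>\<Delta>\<close> dominate all other terms of each equation, so distinct simplices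
  give distinct roots.

  The gap comes from the cone: if \<open>G\<close> induces all \<open>\<Delta>\<^sub>k\<close> and \<open>\<langle>m\<^sub>r, -ln \<gamma>\<rangle>\<close> is large for every
  \<open>r\<close> (which is what the bound on \<open>\<gamma>\<^sup>m\<^sup>r\<close> says), then \<open>-ln \<gamma> - s G\<close> still lies in the cone for a
  large \<open>s\<close>, so \<open>-ln \<gamma> = (-ln \<gamma> - s G) + s G\<close> induces every \<open>\<Delta>\<^sub>k\<close> with a gap proportional to
  \<open>s\<close>.\<close>

definition vec_of_int :: "int^'d::finite \<Rightarrow> real^'d" where
  "vec_of_int a = (\<chi> k. real_of_int (a $ k))"

lemma cay_emb_eq: "cay_emb (a, i) = (vec_of_int a, axis i 1)"
  by (simp add: cay_emb_def vec_of_int_def)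

lemma cay_emb_inject: "cay_emb (a, i) = cay_emb (b, j) \<longleftrightarrow> a = b \<and> i = j"
  by (auto simp: cay_emb_eq axis_eq_axis) (auto simp: vec_of_int_def vec_eq_iff)

lemma inner_cay_emb:
  "inner u (cay_emb (a, i)) + \<mu> = vec_of_int a \<bullet> fst u + (snd u $ i + \<mu>)"
  by (cases u) (simp add: cay_emb_eq inner_axis inner_commute)

lemma finite_cayley:
  assumes "\<And>i. finite (A i)"
  shows "finite (cayley (A :: 'd::finite \<Rightarrow> _))"
proof -
  have "cayley A = (\<Union>i. (\<lambda>a. (a, i)) ` A i)" by (auto simp: cayley_def)
  then show ?thesis using assms by simp
qed

section \<open>Regular cells and height gaps\<close>

definition cell_gap :: "('q \<Rightarrow> 'p::real_inner) \<Rightarrow> 'q set \<Rightarrow> 'q set \<Rightarrow> ('q \<Rightarrow> real) \<Rightarrow> real \<Rightarrow> bool" where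
  "cell_gap emb P Q h g \<longleftrightarrow> (\<exists>u \<mu>. \<forall>q\<in>P. (q \<in> Q \<longrightarrow> inner u (emb q) + \<mu> = h q) \<and>
                                         (q \<notin> Q \<longrightarrow> inner u (emb q) + \<mu> + g \<le> h q))"

lemma cell_gap_mono: "cell_gap emb P Q h g \<Longrightarrow> g' \<le> g \<Longrightarrow> cell_gap emb P Q h g'"
  unfolding cell_gap_def by (meson add_left_mono order_trans)

lemma cell_gap_add:
  assumes "cell_gap emb P Q h g" and "cell_gap emb P Q h' g'"
  shows "cell_gap emb P Q (\<lambda>q. h q + h' q) (g + g')"
proof -
  obtain u \<mu> u' \<mu>' where
    "\<forall>q\<in>P. (q \<in> Q \<longrightarrow> inner u (emb q) + \<mu> = h q) \<and> (q \<notin> Q \<longrightarrow> inner u (emb q) + \<mu> + g \<le> h q)"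
    "\<forall>q\<in>P. (q \<in> Q \<longrightarrow> inner u' (emb q) + \<mu>' = h' q) \<and> (q \<notin> Q \<longrightarrow> inner u' (emb q) + \<mu>' + g' \<le> h' q)"
    using assms unfolding cell_gap_def by blast
  then show ?thesis unfolding cell_gap_def
    by (intro exI[of _ "u + u'"] exI[of _ "\<mu> + \<mu>'"]) (fastforce simp: inner_add_left)
qed

lemma cell_gap_scale:
  assumes "cell_gap emb P Q h g" and "0 \<le> s"
  shows "cell_gap emb P Q (\<lambda>q. s * h q) (s * g)"
proof -
  obtain u \<mu> where u\<mu>:
    "\<forall>q\<in>P. (q \<in> Q \<longrightarrow> inner u (emb q) + \<mu> = h q) \<and> (q \<notin> Q \<longrightarrow> inner u (emb q) + \<mu> + g \<le> h q)"
    using assms(1) unfolding cell_gap_def by blast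
  have scaled: "inner (s *\<^sub>R u) (emb q) + s * \<mu> = s * (inner u (emb q) + \<mu>)" for q
    by (simp add: algebra_simps)
  show ?thesis unfolding cell_gap_def
  proof (intro exI[of _ "s *\<^sub>R u"] exI[of _ "s * \<mu>"] ballI conjI impI)
    fix q assume "q \<in> P"
    show "inner (s *\<^sub>R u) (emb q) + s * \<mu> = s * h q" if "q \<in> Q"
      unfolding scaled using u\<mu> \<open>q \<in> P\<close> that by simp
    show "inner (s *\<^sub>R u) (emb q) + s * \<mu> + s * g \<le> s * h q" if "q \<notin> Q"
    proof -
      have "s * (inner u (emb q) + \<mu> + g) \<le> s * h q"
        using u\<mu> \<open>q \<in> P\<close> that \<open>0 \<le> s\<close> by (simp add: mult_left_mono)
      then show ?thesis unfolding scaled by (simp add: distrib_left)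
    qed
  qed
qed

lemma regular_cell_affine_minorant:
  fixes emb :: "'q \<Rightarrow> 'p::real_inner"
  assumes cell: "regular_cell emb P h Q" and "Q \<noteq> {}"
  shows "\<exists>u \<mu>. \<forall>q\<in>P. inner u (emb q) + \<mu> \<le> h q \<and> (inner u (emb q) + \<mu> = h q \<longleftrightarrow> q \<in> Q)"
proof -
  define lift where "lift = (\<lambda>q. (emb q, h q))"
  define H where "H = convex hull (lift ` P)"
  obtain F where lower: "lower_face (lift ` P) F" and Q: "Q = {q \<in> P. lift q \<in> F}"
    using cell unfolding regular_cell_def lift_def by blast
  obtain u cc where cc: "cc > 0"
    and F: "F = {z \<in> H. \<forall>y \<in> H. inner (u, cc) z \<le> inner (u, cc) y}"
    using lower unfolding lower_face_def H_def by blast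
  define \<psi> where "\<psi> = (\<lambda>q. inner (u, cc) (lift q))"
  have hull: "q \<in> P \<Longrightarrow> lift q \<in> H" for q by (simp add: H_def hull_inc)
  obtain q0 where "q0 \<in> Q" using \<open>Q \<noteq> {}\<close> by blast
  then have q0: "q0 \<in> P" "\<forall>y\<in>H. \<psi> q0 \<le> inner (u, cc) y" using Q F \<psi>_def by auto
  have min: "q \<in> P \<Longrightarrow> \<psi> q0 \<le> \<psi> q" for q
    using q0(2) hull unfolding \<psi>_def by blast
  have contact: "\<psi> q = \<psi> q0 \<longleftrightarrow> q \<in> Q" if "q \<in> P" for q
  proof
    assume "\<psi> q = \<psi> q0"
    then show "q \<in> Q" using q0(2) hull[OF that] that unfolding Q F \<psi>_def by simp
  next
    assume "q \<in> Q"
    then have "\<psi> q \<le> \<psi> q0" using hull[OF q0(1)] unfolding Q F \<psi>_def by simp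
    then show "\<psi> q = \<psi> q0" using min[OF that] by simp
  qed
  define u' where "u' = - (1 / cc) *\<^sub>R u"
  define \<mu> where "\<mu> = \<psi> q0 / cc"
  have diff: "h q - (inner u' (emb q) + \<mu>) = (\<psi> q - \<psi> q0) / cc" for q
    using cc by (simp add: \<psi>_def lift_def u'_def \<mu>_def field_simps)
  have "inner u' (emb q) + \<mu> \<le> h q \<and> (inner u' (emb q) + \<mu> = h q \<longleftrightarrow> q \<in> Q)" if "q \<in> P" for q
  proof -
    have "0 \<le> (\<psi> q - \<psi> q0) / cc" using min[OF that] cc by simp
    moreover have "(\<psi> q - \<psi> q0) / cc = 0 \<longleftrightarrow> q \<in> Q" using contact[OF that] cc by simp
    ultimately show ?thesis using diff[of q] by linarith
  qed
  then show ?thesis by blast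
qed

lemma regular_cell_gap:
  assumes "regular_cell emb P h Q" and "Q \<noteq> {}" and "finite P"
  shows "\<exists>g>0. cell_gap emb P Q h g"
proof -
  obtain u \<mu> where u\<mu>: "\<forall>q\<in>P. inner u (emb q) + \<mu> \<le> h q \<and> (inner u (emb q) + \<mu> = h q \<longleftrightarrow> q \<in> Q)"
    using regular_cell_affine_minorant[OF assms(1,2)] by blast
  define g where "g = Min (insert 1 ((\<lambda>q. h q - (inner u (emb q) + \<mu>)) ` (P - Q)))"
  have "g > 0"
    using u\<mu> \<open>finite P\<close> unfolding g_def by (subst Min_gr_iff) force+
  moreover have "g \<le> h q - (inner u (emb q) + \<mu>)" if "q \<in> P - Q" for q
    using that \<open>finite P\<close> unfolding g_def by (intro Min_le) auto
  ultimately show ?thesis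
    using u\<mu> unfolding cell_gap_def by (intro exI[of _ g] conjI exI[of _ u] exI[of _ \<mu>]) fastforce+
qed

lemma cell_gap_of_cone_height:
  fixes emb :: "'q \<Rightarrow> 'p::real_inner" and m :: "nat \<Rightarrow> 'q \<Rightarrow> real" and p l :: nat
  assumes "finite P" and nonempty: "\<And>k. k < p \<Longrightarrow> Q k \<noteq> {}"
    and cone: "\<And>h. (\<forall>k<p. regular_cell emb P h (Q k)) \<longleftrightarrow> (\<forall>r<l. (\<Sum>q\<in>P. m r q * h q) > 0)"
    and "\<exists>G. \<forall>k<p. regular_cell emb P G (Q k)"
  shows "\<exists>K\<ge>0. \<forall>M H. 0 \<le> M \<longrightarrow> (\<forall>r<l. K * M < (\<Sum>q\<in>P. m r q * H q)) \<longrightarrow>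
           (\<forall>k<p. cell_gap emb P (Q k) H M)"
proof -
  obtain G where G: "\<forall>k<p. regular_cell emb P G (Q k)" using assms(4) by blast
  have "\<exists>g>0. cell_gap emb P (Q k) G g" if "k < p" for k
    using regular_cell_gap[OF _ nonempty[OF that] \<open>finite P\<close>] G that by blast
  then obtain g where g: "\<And>k. k < p \<Longrightarrow> g k > 0 \<and> cell_gap emb P (Q k) G (g k)" by metis
  define gmin where "gmin = Min (insert 1 (g ` {..<p}))"
  have gmin_pos: "gmin > 0" unfolding gmin_def using g by (auto simp: Min_gr_iff)
  have gmin_le: "k < p \<Longrightarrow> gmin \<le> g k" for k unfolding gmin_def by (intro Min_le) auto
  define Mm where "Mm = Max (insert 0 ((\<lambda>r. \<Sum>q\<in>P. m r q * G q) ` {..<l}))"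
  have Mm_nonneg: "Mm \<ge> 0" unfolding Mm_def by (intro Max_ge) auto
  have Mm_ge: "r < l \<Longrightarrow> (\<Sum>q\<in>P. m r q * G q) \<le> Mm" for r unfolding Mm_def by (intro Max_ge) auto
  show ?thesis
  proof (intro exI[of _ "Mm / gmin"] conjI allI impI)
    show "0 \<le> Mm / gmin" using gmin_pos Mm_nonneg by simp
    fix M H k
    assume M: "0 \<le> M" and H: "\<forall>r<l. Mm / gmin * M < (\<Sum>q\<in>P. m r q * H q)" and k: "k < p"
    define s where "s = M / gmin"
    have s: "s \<ge> 0" "M \<le> s * g k"
      using M gmin_pos mult_left_mono[OF gmin_le[OF k] M] by (auto simp: s_def field_simps)
    have "(\<Sum>q\<in>P. m r q * (H q - s * G q)) > 0" if "r < l" for r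
    proof -
      have "(\<Sum>q\<in>P. m r q * (H q - s * G q)) = (\<Sum>q\<in>P. m r q * H q) - s * (\<Sum>q\<in>P. m r q * G q)"
        by (simp add: algebra_simps sum_subtractf sum_distrib_left)
      moreover have "s * (\<Sum>q\<in>P. m r q * G q) \<le> s * Mm" using Mm_ge[OF that] s(1) by (rule mult_left_mono)
      moreover have "s * Mm = Mm / gmin * M" by (simp add: s_def)
      ultimately show ?thesis using H[rule_format, OF that] by linarith
    qed
    then have "regular_cell emb P (\<lambda>q. H q - s * G q) (Q k)" using cone k by blast
    then have "cell_gap emb P (Q k) (\<lambda>q. H q - s * G q) 0"
      using regular_cell_gap nonempty[OF k] \<open>finite P\<close> cell_gap_mono by (metis less_imp_le)
    moreover have "cell_gap emb P (Q k) (\<lambda>q. s * G q) (s * g k)" using g[OF k] s(1) by (blast intro: cell_gap_scale)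
    ultimately have "cell_gap emb P (Q k) (\<lambda>q. H q - s * G q + s * G q) (0 + s * g k)" by (rule cell_gap_add)
    then show "cell_gap emb P (Q k) H M" using s(2) by (auto intro: cell_gap_mono)
  qed
qed

section \<open>Mixed simplices\<close>

lemma mixed_simplex_pairs:
  assumes "mixed_simplex A S"
  obtains a1 a2 where "\<And>i. a1 i \<noteq> a2 i" and "\<And>a i. (a, i) \<in> S \<longleftrightarrow> a = a1 i \<or> a = a2 i"
proof -
  have "\<exists>x y. x \<noteq> y \<and> {a. (a, i) \<in> S} = {x, y}" for i
    using assms unfolding mixed_simplex_def card_2_iff by blast
  then obtain a1 a2 where "\<And>i. a1 i \<noteq> a2 i \<and> {a. (a, i) \<in> S} = {a1 i, a2 i}" by metis
  then show thesis by (intro that) (auto simp: set_eq_iff)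
qed

definition pair_matrix :: "('d::finite \<Rightarrow> int^'d) \<Rightarrow> ('d \<Rightarrow> int^'d) \<Rightarrow> real^'d^'d" where
  "pair_matrix a1 a2 = (\<chi> i. vec_of_int (a2 i) - vec_of_int (a1 i))"

lemma affine_dependent_opposite_pairs:
  fixes x y :: "'i::finite \<Rightarrow> 'a::real_vector"
  assumes E: "finite E" "range x \<subseteq> E" "range y \<subseteq> E"
    and "inj y" and "y j \<notin> range x"
    and zero: "(\<Sum>i\<in>UNIV. \<mu> i *\<^sub>R (y i - x i)) = 0" and "\<mu> j \<noteq> 0"
  shows "affine_dependent E"
proof -
  define U where "U p = (\<Sum>i\<in>UNIV. (if p = y i then \<mu> i else 0) - (if p = x i then \<mu> i else 0))" for p
  have "sum U E = (\<Sum>i\<in>UNIV. \<Sum>p\<in>E. (if p = y i then \<mu> i else 0) - (if p = x i then \<mu> i else 0))"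
    unfolding U_def by (rule sum.swap)
  also have "\<dots> = 0" using E by (simp add: sum_subtractf range_subsetD)
  finally have sum_U: "sum U E = 0" .
  have "(\<Sum>p\<in>E. U p *\<^sub>R p) =
      (\<Sum>i\<in>UNIV. \<Sum>p\<in>E. (if p = y i then \<mu> i *\<^sub>R y i else 0) - (if p = x i then \<mu> i *\<^sub>R x i else 0))"
    unfolding U_def scaleR_sum_left by (subst sum.swap) (intro sum.cong refl; simp add: scaleR_diff_left)
  also have "\<dots> = 0" using E zero by (simp add: sum_subtractf range_subsetD scaleR_diff_right)
  finally have weighted_sum_U: "(\<Sum>p\<in>E. U p *\<^sub>R p) = 0" .
  have "U (y j) = (\<Sum>i\<in>UNIV. if i = j then \<mu> i else 0)"
    unfolding U_def using \<open>inj y\<close> \<open>y j \<notin> range x\<close> by (intro sum.cong) (auto simp: inj_eq)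
  then have "U (y j) \<noteq> 0" using \<open>\<mu> j \<noteq> 0\<close> by simp
  moreover have "y j \<in> E" using E(3) by auto
  ultimately show ?thesis
    unfolding affine_dependent_explicit_finite[OF E(1)] using sum_U weighted_sum_U by blast
qed

lemma invertible_pair_matrix:
  fixes A :: "'d::finite \<Rightarrow> (int^'d) set"
  assumes "cay_simplex A S" and S: "\<And>a i. (a, i) \<in> S \<longleftrightarrow> a = a1 i \<or> a = a2 i"
    and ne: "\<And>i. a1 i \<noteq> a2 i"
  shows "invertible (pair_matrix a1 a2)"
  unfolding invertible_right_inverse matrix_right_invertible_independent_rows
proof (intro allI impI)
  fix \<mu> :: "'d \<Rightarrow> real" and j
  assume rows: "(\<Sum>i\<in>UNIV. \<mu> i *s row i (pair_matrix a1 a2)) = 0"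
  show "\<mu> j = 0"
  proof (rule ccontr)
    assume "\<mu> j \<noteq> 0"
    have "finite S" using assms(1) by (auto simp: cay_simplex_def intro: card_ge_0_finite)
    have "row i (pair_matrix a1 a2) = vec_of_int (a2 i) - vec_of_int (a1 i)" for i
      by (simp add: row_def pair_matrix_def vec_eq_iff)
    then have "(\<Sum>i\<in>UNIV. \<mu> i *\<^sub>R (cay_emb (a2 i, i) - cay_emb (a1 i, i)))
        = ((\<Sum>i\<in>UNIV. \<mu> i *s row i (pair_matrix a1 a2)), 0)"
      by (simp add: cay_emb_eq scalar_mult_eq_scaleR prod_eq_iff fst_sum snd_sum)
    also have "\<dots> = 0" using rows by (simp add: zero_prod_def)
    finally have "affine_dependent (cay_emb ` S)"
      using \<open>finite S\<close> \<open>\<mu> j \<noteq> 0\<close> ne ne[THEN not_sym] S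
      by (intro affine_dependent_opposite_pairs[where x = "\<lambda>i. cay_emb (a1 i, i)"
            and y = "\<lambda>i. cay_emb (a2 i, i)" and j = j and \<mu> = \<mu>])
         (auto simp: inj_def cay_emb_inject)
    then show False using assms(1) by (simp add: cay_simplex_def)
  qed
qed

section \<open>Monomial systems\<close>

lemma monom_exp: "monom (\<chi> j. exp (y $ j)) a = exp (vec_of_int a \<bullet> y)"
  by (simp add: monom_def powr_def vec_of_int_def inner_vec_def exp_sum mult.commute)

lemma monom_pos: "(\<And>k. x $ k > 0) \<Longrightarrow> monom x a > 0"
  unfolding monom_def by (rule prod_pos) (metis powr_gt_zero less_irrefl)

lemma has_derivative_monom:
  fixes x :: "real^'d::finite"
  assumes pos: "\<And>k. x $ k > 0"
  shows "((\<lambda>x. monom x a) has_derivative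
           (\<lambda>h. monom x a * (vec_of_int a \<bullet> (\<chi> j. h $ j / x $ j)))) (at x)"
proof -
  define f where "f k y = y $ k powr real_of_int (a $ k)" for k and y :: "real^'d"
  have "((\<lambda>y. f k y) has_derivative
      (\<lambda>h. f k x * (0 * ln (x $ k) + h $ k * real_of_int (a $ k) / x $ k))) (at x)" for k
    unfolding f_def
    by (rule has_derivative_powr[OF bounded_linear.has_derivative[OF bounded_linear_vec_nth]
          has_derivative_const]) (use pos in auto)
  then have prod: "((\<lambda>y. \<Prod>k\<in>UNIV. f k y) has_derivative (\<lambda>h. \<Sum>k\<in>UNIV.
      f k x * (0 * ln (x $ k) + h $ k * real_of_int (a $ k) / x $ k) * (\<Prod>j\<in>UNIV - {k}. f j x))) (at x)"
    by (rule has_derivative_prod)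
  have factor: "f k x * (0 * ln (x $ k) + h $ k * real_of_int (a $ k) / x $ k) * (\<Prod>j\<in>UNIV - {k}. f j x)
      = monom x a * (real_of_int (a $ k) * (h $ k / x $ k))" for h k
    by (simp add: monom_def f_def prod.remove[of UNIV k])
  have "(\<lambda>h. \<Sum>k\<in>UNIV.
      f k x * (0 * ln (x $ k) + h $ k * real_of_int (a $ k) / x $ k) * (\<Prod>j\<in>UNIV - {k}. f j x))
      = (\<lambda>h. monom x a * (vec_of_int a \<bullet> (\<chi> j. h $ j / x $ j)))"
    unfolding factor by (simp add: inner_vec_def vec_of_int_def sum_distrib_left)
  moreover have "(\<lambda>y. \<Prod>k\<in>UNIV. f k y) = (\<lambda>y. monom y a)" by (simp add: monom_def f_def)
  ultimately show ?thesis using prod by simp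
qed

definition cay_system_deriv :: "('d::finite \<Rightarrow> (int^'d) set) \<Rightarrow> ((int^'d) \<times> 'd \<Rightarrow> real)
    \<Rightarrow> ((int^'d) \<times> 'd \<Rightarrow> real) \<Rightarrow> real^'d \<Rightarrow> real^'d \<Rightarrow> real^'d" where
  "cay_system_deriv A c \<gamma> x h =
     (\<chi> i. \<Sum>a\<in>A i. c (a, i) * \<gamma> (a, i) * (monom x a * (vec_of_int a \<bullet> (\<chi> j. h $ j / x $ j))))"

lemma has_derivative_cay_system:
  assumes "\<And>k. x $ k > 0"
  shows "(cay_system A c \<gamma> has_derivative cay_system_deriv A c \<gamma> x) (at x)"
proof -
  have "((\<lambda>y. cay_system A c \<gamma> y \<bullet> b) has_derivative (\<lambda>h. cay_system_deriv A c \<gamma> x h \<bullet> b)) (at x)"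
    if basis: "b \<in> Basis" for b
  proof -
    obtain i where b: "b = axis i 1" using basis by (auto simp: Basis_vec_def)
    have "((\<lambda>y. \<Sum>a\<in>A i. c (a, i) * \<gamma> (a, i) * monom y a) has_derivative (\<lambda>h. \<Sum>a\<in>A i.
        c (a, i) * \<gamma> (a, i) * (monom x a * (vec_of_int a \<bullet> (\<chi> j. h $ j / x $ j))))) (at x)"
      by (intro has_derivative_sum has_derivative_mult_right has_derivative_monom assms)
    then show ?thesis by (simp add: b inner_axis cay_system_def cay_system_deriv_def)
  qed
  then show ?thesis by (rule iffD2[OF has_derivative_componentwise_within, rule_format])
qed

lemma nondegenerate_if_injective_derivative:
  fixes F :: "real^'n::finite \<Rightarrow> real^'n"
  assumes "(F has_derivative F') (at x)" and "\<And>h. F' h = 0 \<Longrightarrow> h = 0"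
  shows "nondegenerate F x"
proof -
  have "linear F'" using assms(1) by (rule has_derivative_linear)
  then have "det (matrix F') \<noteq> 0" using assms(2) by (simp add: det_nz_iff_inj linear_injective_0)
  then show ?thesis using assms(1) unfolding nondegenerate_def by blast
qed

section \<open>Perturbed binomial systems\<close>

lemma exp_sub_one_sub_le:
  fixes t :: real
  assumes "\<bar>t\<bar> \<le> 1/4"
  shows "exp t - 1 - t \<le> 1/12"
proof -
  have "exp t * (1 - t) \<le> exp t * exp (- t)"
    using exp_ge_add_one_self[of "- t"] by (intro mult_left_mono) auto
  moreover have "1 - t > 0" using assms by auto
  ultimately have "exp t - 1 - t \<le> 1 / (1 - t) - 1 - t" by (simp add: exp_minus field_simps)
  also have "\<dots> = t\<^sup>2 / (1 - t)" using \<open>1 - t > 0\<close> by (simp add: field_simps power2_eq_square)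
  also have "\<dots> \<le> (1/16) / (3/4)"
  proof (rule frac_le)
    have "\<bar>t\<bar>\<^sup>2 \<le> (1/4)\<^sup>2" using assms by (intro power_mono) auto
    then show "t\<^sup>2 \<le> 1/16" by (simp add: power2_abs power_divide)
  qed (use assms in auto)
  finally show ?thesis by simp
qed

lemma infnorm_le_cart: "(\<And>i. \<bar>x $ i\<bar> \<le> b) \<Longrightarrow> infnorm (x :: real^'n) \<le> b"
  unfolding infnorm_cart by (rule cSup_least) auto

lemma zero_if_components_le_infnorm:
  fixes x :: "real^'n"
  assumes "\<And>i. \<bar>x $ i\<bar> \<le> q * infnorm x" and "q < 1"
  shows "x = 0"
proof -
  have "infnorm x \<le> q * infnorm x" using assms(1) by (rule infnorm_le_cart)
  then have "infnorm x = 0" using \<open>q < 1\<close> infnorm_pos_le[of x]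
    by (metis mult_le_cancel_right1 not_le order.antisym)
  then show ?thesis by (simp add: infnorm_eq_0)
qed

lemma binomial_newton_step_bound:
  fixes c1 c2 e t :: real
  assumes "c1 * c2 < 0" and t: "\<bar>t\<bar> \<le> 1/4" and "\<bar>e\<bar> \<le> \<bar>c1\<bar> / 8"
  shows "\<bar>t + (c1 + c2 * exp (ln (- c1 / c2) + t) + e) / c1\<bar> \<le> 1/4"
proof -
  have "c1 \<noteq> 0" "c2 \<noteq> 0" "- c1 / c2 > 0"
    using assms(1) by (auto simp: divide_less_0_iff mult_less_0_iff)
  then have "c2 * exp (ln (- c1 / c2) + t) = - c1 * exp t" by (simp add: exp_add)
  then have "t + (c1 + c2 * exp (ln (- c1 / c2) + t) + e) / c1 = - (exp t - 1 - t) + e / c1"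
    using \<open>c1 \<noteq> 0\<close> by (simp add: field_simps)
  moreover have "\<bar>e / c1\<bar> \<le> 1/8" using assms(3) \<open>c1 \<noteq> 0\<close> by (simp add: abs_divide field_simps)
  ultimately show ?thesis
    using exp_sub_one_sub_le[OF t] exp_ge_add_one_self[of t] unfolding abs_le_iff by linarith
qed

lemma cube_eq_cbox: "{v :: real^'n. \<forall>i. \<bar>v $ i - s $ i\<bar> \<le> r} = cbox (s - (\<chi> i. r)) (s + (\<chi> i. r))"
proof -
  have "\<bar>v $ i - s $ i\<bar> \<le> r \<longleftrightarrow> s $ i - r \<le> v $ i \<and> v $ i \<le> s $ i + r" for v :: "real^'n" and i
    by arith
  then show ?thesis by (simp add: mem_box_cart set_eq_iff)
qed

text \<open>The map \<open>v \<mapsto> v + F(v) / c\<^sub>1\<close> is Newton's method for \<open>F(v) = c\<^sub>1 + c\<^sub>2 e\<^sup>v + E(v)\<close> with the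
  derivative frozen at the root \<open>s\<close> of the unperturbed equation; it maps the cube of radius
  \<open>1/4\<close> around \<open>s\<close> into itself, and Brouwer's theorem gives a fixed point.\<close>

lemma perturbed_binomial_root:
  fixes c1 c2 :: "'d::finite \<Rightarrow> real" and E :: "real^'d \<Rightarrow> 'd \<Rightarrow> real" and s :: "real^'d"
  assumes signs: "\<And>i. c1 i * c2 i < 0" and s: "\<And>i. s $ i = ln (- c1 i / c2 i)"
    and S: "S = {v. \<forall>i. \<bar>v $ i - s $ i\<bar> \<le> 1/4}"
    and cont: "\<And>i. continuous_on S (\<lambda>v. E v i)"
    and small: "\<And>v i. v \<in> S \<Longrightarrow> \<bar>E v i\<bar> \<le> \<bar>c1 i\<bar> / 8"
  shows "\<exists>v\<in>S. \<forall>i. c1 i + c2 i * exp (v $ i) + E v i = 0"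
proof -
  have c1: "c1 i \<noteq> 0" for i using signs[of i] by auto
  define \<Phi> where "\<Phi> v = (\<chi> i. v $ i + (c1 i + c2 i * exp (v $ i) + E v i) / c1 i)" for v
  have "\<Phi> v \<in> S" if "v \<in> S" for v
  proof -
    have "\<bar>\<Phi> v $ i - s $ i\<bar> \<le> 1/4" for i
    proof -
      have step: "\<Phi> v $ i - s $ i = (v $ i - s $ i)
          + (c1 i + c2 i * exp (ln (- c1 i / c2 i) + (v $ i - s $ i)) + E v i) / c1 i"
        by (simp add: \<Phi>_def s)
      show ?thesis unfolding step
        by (rule binomial_newton_step_bound[OF signs]) (use that small[OF that] in \<open>simp_all add: S\<close>)
    qed
    then show ?thesis by (simp add: S)
  qed
  moreover have "continuous_on S \<Phi>" unfolding \<Phi>_def using c1 by (intro continuous_intros cont) auto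
  moreover have "s \<in> S" by (simp add: S)
  moreover have "compact S" "convex S" unfolding S cube_eq_cbox by (simp_all add: compact_cbox convex_box)
  ultimately obtain v where "v \<in> S" "\<Phi> v = v" using brouwer[of S \<Phi>] by blast
  then have "(c1 i + c2 i * exp (v $ i) + E v i) / c1 i = 0" for i
    by (simp add: \<Phi>_def vec_eq_iff)
  then show ?thesis using \<open>v \<in> S\<close> c1 by auto
qed

section \<open>The solution attached to a positively decorated mixed simplex\<close>

definition pair_dominant :: "('d::finite \<Rightarrow> (int^'d) set) \<Rightarrow> ((int^'d) \<times> 'd \<Rightarrow> real)
    \<Rightarrow> ('d \<Rightarrow> int^'d) \<Rightarrow> ('d \<Rightarrow> int^'d) \<Rightarrow> real^'d \<Rightarrow> bool" where
  "pair_dominant A \<gamma> a1 a2 x \<longleftrightarrow> (\<forall>i. \<forall>a\<in>A i - {a1 i, a2 i}.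
     \<gamma> (a, i) * monom x a < \<gamma> (a1 i, i) * monom x (a1 i) \<and>
     \<gamma> (a, i) * monom x a < \<gamma> (a2 i, i) * monom x (a2 i))"

lemma pair_dominant_same_pairs:
  assumes dom_a: "pair_dominant A \<gamma> a1 a2 x" and dom_b: "pair_dominant A \<gamma> b1 b2 x"
    and sub: "{a1 i, a2 i, b1 i, b2 i} \<subseteq> A i" and "a1 i \<noteq> a2 i" and "b1 i \<noteq> b2 i"
  shows "{a1 i, a2 i} = {b1 i, b2 i}"
proof (rule ccontr)
  assume differ: "{a1 i, a2 i} \<noteq> {b1 i, b2 i}"
  define T where "T a = \<gamma> (a, i) * monom x a" for a
  have "\<not> {a1 i, a2 i} \<subseteq> {b1 i, b2 i}" using differ \<open>a1 i \<noteq> a2 i\<close> by auto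
  then obtain a where a: "a \<in> {a1 i, a2 i}" "a \<notin> {b1 i, b2 i}" by blast
  have "\<not> {b1 i, b2 i} \<subseteq> {a1 i, a2 i}" using differ \<open>b1 i \<noteq> b2 i\<close> by auto
  then obtain b where b: "b \<in> {b1 i, b2 i}" "b \<notin> {a1 i, a2 i}" by blast
  have "a \<in> A i - {b1 i, b2 i}" "b \<in> A i - {a1 i, a2 i}" using a b sub by auto
  then have "T a < T (b1 i) \<and> T a < T (b2 i)" "T b < T (a1 i) \<and> T b < T (a2 i)"
    using dom_a dom_b unfolding pair_dominant_def T_def by blast+
  then show False using a(1) b(1) by auto
qed

locale decorated_pair =
  fixes A :: "'d::finite \<Rightarrow> (int^'d) set" and c :: "(int^'d) \<times> 'd \<Rightarrow> real"
    and a1 a2 :: "'d \<Rightarrow> int^'d"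
  assumes finite_A: "\<And>i. finite (A i)"
    and a1_in: "\<And>i. a1 i \<in> A i" and a2_in: "\<And>i. a2 i \<in> A i"
    and a1_ne_a2: "\<And>i. a1 i \<noteq> a2 i"
    and opposite_signs: "\<And>i. c (a1 i, i) * c (a2 i, i) < 0"
    and invertible: "invertible (pair_matrix a1 a2)"
begin

definition pair_inv :: "real^'d^'d" where
  "pair_inv = matrix_inv (pair_matrix a1 a2)"

lemma pair_inv_inverse: "pair_matrix a1 a2 ** pair_inv = mat 1" "pair_inv ** pair_matrix a1 a2 = mat 1"
  using someI_ex[OF invertible[unfolded invertible_def]] by (simp_all add: pair_inv_def matrix_inv_def)

lemma pair_matrix_mult_nth: "(pair_matrix a1 a2 *v u) $ i = (vec_of_int (a2 i) - vec_of_int (a1 i)) \<bullet> u"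
  by (simp add: pair_matrix_def matrix_vector_mult_def inner_vec_def mult.commute)

lemma pair_diff_inner_pair_inv: "(vec_of_int (a2 i) - vec_of_int (a1 i)) \<bullet> (pair_inv *v v) = v $ i"
  using pair_matrix_mult_nth[of "pair_inv *v v" i] by (simp add: matrix_vector_mul_assoc pair_inv_inverse)

definition root_center :: "real^'d" where
  "root_center = (\<chi> i. ln (- c (a1 i, i) / c (a2 i, i)))"

definition root_box :: "(real^'d) set" where
  "root_box = {v. \<forall>i. \<bar>v $ i - root_center $ i\<bar> \<le> 1/4}"

lemma c2_exp_root_center: "c (a2 i, i) * exp (root_center $ i) = - c (a1 i, i)"
proof -
  have "- c (a1 i, i) / c (a2 i, i) > 0"
    using opposite_signs[of i] by (auto simp: divide_less_0_iff mult_less_0_iff)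
  then show ?thesis using opposite_signs[of i] by (auto simp: root_center_def)
qed

lemma infnorm_root_box: "v \<in> root_box \<Longrightarrow> infnorm v \<le> infnorm root_center + 1"
proof -
  assume "v \<in> root_box"
  then have "infnorm (v - root_center) \<le> 1/4" by (intro infnorm_le_cart) (simp add: root_box_def)
  then show ?thesis using infnorm_triangle[of root_center "v - root_center"] by simp
qed

definition spread :: real where
  "spread = (\<Sum>i\<in>UNIV. \<Sum>a\<in>A i. norm (vec_of_int a - vec_of_int (a1 i)))
      * onorm ((*v) pair_inv) * sqrt CARD('d)"

lemma spread_nonneg: "0 \<le> spread"
  by (simp add: spread_def onorm_pos_le sum_nonneg)

lemma inner_pair_inv_le_spread:
  assumes "a \<in> A i"
  shows "\<bar>(vec_of_int a - vec_of_int (a1 i)) \<bullet> (pair_inv *v z)\<bar> \<le> spread * infnorm z"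
proof -
  have "norm (vec_of_int a - vec_of_int (a1 i)) \<le> (\<Sum>a\<in>A i. norm (vec_of_int a - vec_of_int (a1 i)))"
    using assms finite_A by (intro member_le_sum) auto
  also have "\<dots> \<le> (\<Sum>i\<in>UNIV. \<Sum>a\<in>A i. norm (vec_of_int a - vec_of_int (a1 i)))"
    by (intro member_le_sum) (auto intro: sum_nonneg)
  finally have diff: "norm (vec_of_int a - vec_of_int (a1 i))
      \<le> (\<Sum>i\<in>UNIV. \<Sum>a\<in>A i. norm (vec_of_int a - vec_of_int (a1 i)))" .
  have "norm (pair_inv *v z) \<le> onorm ((*v) pair_inv) * norm z" by (simp add: onorm)
  also have "\<dots> \<le> onorm ((*v) pair_inv) * (sqrt CARD('d) * infnorm z)"
    using norm_le_infnorm[of z] by (intro mult_left_mono) (auto simp: onorm_pos_le)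
  finally have norm_Binv: "norm (pair_inv *v z) \<le> onorm ((*v) pair_inv) * sqrt CARD('d) * infnorm z" by simp
  have "\<bar>(vec_of_int a - vec_of_int (a1 i)) \<bullet> (pair_inv *v z)\<bar>
      \<le> norm (vec_of_int a - vec_of_int (a1 i)) * norm (pair_inv *v z)"
    by (rule Cauchy_Schwarz_ineq2)
  also have "\<dots> \<le> (\<Sum>i\<in>UNIV. \<Sum>a\<in>A i. norm (vec_of_int a - vec_of_int (a1 i)))
      * (onorm ((*v) pair_inv) * sqrt CARD('d) * infnorm z)"
    using diff norm_Binv by (intro mult_mono) (simp_all add: sum_nonneg)
  finally show ?thesis by (simp add: spread_def mult.assoc)
qed

definition coeff_mass :: real where
  "coeff_mass = 1 + (\<Sum>i\<in>UNIV. \<Sum>a\<in>A i. \<bar>c (a, i)\<bar>)"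

definition min_coeff :: real where
  "min_coeff = Min (range (\<lambda>i. \<bar>c (a1 i, i)\<bar>))"

definition min_exp_box :: real where
  "min_exp_box = Min (range (\<lambda>i. exp (root_center $ i - 1/4)))"

definition tail_bound :: real where
  "tail_bound = min (min_coeff / (8 * coeff_mass * (1 + spread))) (min (min_exp_box / 2) (1/2))"

definition gap :: real where
  "gap = spread * (infnorm root_center + 1) - ln tail_bound"

lemma coeff_mass_pos: "coeff_mass > 0"
  unfolding coeff_mass_def by (smt (verit) sum_nonneg abs_ge_zero)

lemma min_coeff: "0 < min_coeff" "min_coeff \<le> \<bar>c (a1 i, i)\<bar>"
proof -
  have "c (a1 i, i) \<noteq> 0" for i using opposite_signs[of i] by auto
  then show "0 < min_coeff" "min_coeff \<le> \<bar>c (a1 i, i)\<bar>" by (auto simp: min_coeff_def)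
qed

lemma min_exp_box: "0 < min_exp_box" "min_exp_box \<le> exp (root_center $ i - 1/4)"
  by (auto simp: min_exp_box_def)

lemma tail_bound:
  shows "0 < tail_bound" and "tail_bound < 1" and "tail_bound < min_exp_box"
    and "coeff_mass * tail_bound * (1 + spread) \<le> min_coeff / 8"
proof -
  have pos: "0 < 8 * coeff_mass * (1 + spread)" using coeff_mass_pos spread_nonneg by simp
  then show "0 < tail_bound" "tail_bound < 1" "tail_bound < min_exp_box"
    using min_coeff(1) min_exp_box(1) by (auto simp: tail_bound_def)
  have "tail_bound \<le> min_coeff / (8 * coeff_mass * (1 + spread))" by (simp add: tail_bound_def)
  then show "coeff_mass * tail_bound * (1 + spread) \<le> min_coeff / 8"
    using pos by (simp add: field_simps)
qed

lemma abs_c2_exp_ge: "v \<in> root_box \<Longrightarrow> 3/4 * min_coeff \<le> \<bar>c (a2 i, i) * exp (v $ i)\<bar>"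
proof -
  assume "v \<in> root_box"
  then have "\<bar>v $ i - root_center $ i\<bar> \<le> 1/4" by (simp add: root_box_def)
  then have "3/4 \<le> exp (v $ i - root_center $ i)"
    using exp_ge_add_one_self[of "v $ i - root_center $ i"] unfolding abs_le_iff by linarith
  then have "min_coeff * (3/4) \<le> \<bar>c (a1 i, i)\<bar> * exp (v $ i - root_center $ i)"
    using min_coeff by (intro mult_mono) auto
  moreover have "c (a2 i, i) * exp (v $ i) = - c (a1 i, i) * exp (v $ i - root_center $ i)"
    using c2_exp_root_center[of i] by (simp add: exp_diff field_simps)
  ultimately show ?thesis by (simp add: abs_mult)
qed

context
  fixes \<gamma> :: "(int^'d) \<times> 'd \<Rightarrow> real" and w :: "real^'d" and lam :: "'d \<Rightarrow> real"
  assumes \<gamma>_pos: "\<And>i a. a \<in> A i \<Longrightarrow> \<gamma> (a, i) > 0"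
    and on_pair: "\<And>i a. a \<in> {a1 i, a2 i} \<Longrightarrow> - ln (\<gamma> (a, i)) = vec_of_int a \<bullet> w + lam i"
    and off_pair: "\<And>i a. a \<in> A i - {a1 i, a2 i} \<Longrightarrow> vec_of_int a \<bullet> w + lam i + gap \<le> - ln (\<gamma> (a, i))"
begin

text \<open>\<open>weight v a i\<close> is the \<open>a\<close>-term of equation \<open>i\<close> at \<open>point v\<close> divided by its \<open>a1 i\<close>-term.\<close>

definition point :: "real^'d \<Rightarrow> real^'d" where
  "point v = (\<chi> j. exp ((w + pair_inv *v v) $ j))"

definition weight :: "real^'d \<Rightarrow> int^'d \<Rightarrow> 'd \<Rightarrow> real" where
  "weight v a i = exp (ln (\<gamma> (a, i)) + vec_of_int a \<bullet> w + lam i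
                       + (vec_of_int a - vec_of_int (a1 i)) \<bullet> (pair_inv *v v))"

definition reduced :: "real^'d \<Rightarrow> 'd \<Rightarrow> real" where
  "reduced v i = (\<Sum>a\<in>A i. c (a, i) * weight v a i)"

lemma point_pos: "point v $ k > 0"
  by (simp add: point_def)

lemma term_eq_weight:
  assumes "a \<in> A i"
  shows "\<gamma> (a, i) * monom (point v) a = \<gamma> (a1 i, i) * monom (point v) (a1 i) * weight v a i"
proof -
  have term_exp: "\<gamma> (b, i) * monom (point v) b = exp (ln (\<gamma> (b, i)) + vec_of_int b \<bullet> (w + pair_inv *v v))"
    if "b \<in> A i" for b
  proof -
    have "monom (point v) b = exp (vec_of_int b \<bullet> (w + pair_inv *v v))"
      unfolding point_def by (rule monom_exp)
    then show ?thesis using \<gamma>_pos[OF that] by (simp add: exp_add)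
  qed
  have "ln (\<gamma> (a1 i, i)) + vec_of_int (a1 i) \<bullet> w = - lam i" using on_pair[of "a1 i" i] by simp
  then show ?thesis
    unfolding term_exp[OF assms] term_exp[OF a1_in] weight_def
    by (simp add: inner_add_right inner_diff_left algebra_simps flip: exp_add)
qed

lemma weight_a1: "weight v (a1 i) i = 1"
  using on_pair[of "a1 i" i] by (simp add: weight_def)

lemma weight_a2: "weight v (a2 i) i = exp (v $ i)"
  using on_pair[of "a2 i" i] by (simp add: weight_def pair_diff_inner_pair_inv)

lemma weight_off_pair_le:
  assumes "v \<in> root_box" and "a \<in> A i - {a1 i, a2 i}"
  shows "weight v a i \<le> tail_bound"
proof -
  have "(vec_of_int a - vec_of_int (a1 i)) \<bullet> (pair_inv *v v) \<le> spread * infnorm v"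
    using inner_pair_inv_le_spread[of a i v] assms(2) by simp
  also have "\<dots> \<le> spread * (infnorm root_center + 1)"
    using infnorm_root_box[OF assms(1)] spread_nonneg by (rule mult_left_mono)
  finally have "ln (\<gamma> (a, i)) + vec_of_int a \<bullet> w + lam i + (vec_of_int a - vec_of_int (a1 i)) \<bullet> (pair_inv *v v)
      \<le> ln tail_bound"
    using off_pair[OF assms(2)] by (simp add: gap_def)
  then show ?thesis using tail_bound(1) unfolding weight_def by (metis exp_le_cancel_iff exp_ln)
qed

lemma cay_system_point:
  "cay_system A c \<gamma> (point v) $ i = \<gamma> (a1 i, i) * monom (point v) (a1 i) * reduced v i"
proof -
  have "cay_system A c \<gamma> (point v) $ i = (\<Sum>a\<in>A i. c (a, i) * (\<gamma> (a, i) * monom (point v) a))"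
    by (simp add: cay_system_def mult.assoc)
  also have "\<dots> = (\<Sum>a\<in>A i. c (a, i) * (\<gamma> (a1 i, i) * monom (point v) (a1 i) * weight v a i))"
    by (intro sum.cong refl) (simp add: term_eq_weight)
  also have "\<dots> = \<gamma> (a1 i, i) * monom (point v) (a1 i) * reduced v i"
    by (simp add: reduced_def sum_distrib_left mult_ac)
  finally show ?thesis .
qed

lemma sum_split_pair: "(\<Sum>a\<in>A i. f a) = f (a1 i) + f (a2 i) + (\<Sum>a\<in>A i - {a1 i, a2 i}. f a)"
proof -
  have "A i = insert (a1 i) (insert (a2 i) (A i - {a1 i, a2 i}))" using a1_in a2_in by auto
  then have "(\<Sum>a\<in>A i. f a) = (\<Sum>a\<in>insert (a1 i) (insert (a2 i) (A i - {a1 i, a2 i})). f a)"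
    by simp
  also have "\<dots> = f (a1 i) + f (a2 i) + (\<Sum>a\<in>A i - {a1 i, a2 i}. f a)"
    using finite_A[of i] a1_ne_a2[of i] by (simp add: algebra_simps)
  finally show ?thesis .
qed

lemma reduced_eq: "reduced v i = c (a1 i, i) + c (a2 i, i) * exp (v $ i)
    + (\<Sum>a\<in>A i - {a1 i, a2 i}. c (a, i) * weight v a i)"
  by (simp add: reduced_def sum_split_pair[of _ i] weight_a1 weight_a2)

lemma tail_mass_le:
  assumes "v \<in> root_box"
  shows "(\<Sum>a\<in>A i - {a1 i, a2 i}. \<bar>c (a, i)\<bar> * weight v a i) \<le> coeff_mass * tail_bound"
proof -
  have "(\<Sum>a\<in>A i - {a1 i, a2 i}. \<bar>c (a, i)\<bar> * weight v a i) \<le> (\<Sum>a\<in>A i - {a1 i, a2 i}. \<bar>c (a, i)\<bar>) * tail_bound"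
    unfolding sum_distrib_right
    by (intro sum_mono mult_left_mono weight_off_pair_le assms) auto
  also have "\<dots> \<le> coeff_mass * tail_bound"
  proof (intro mult_right_mono)
    have "(\<Sum>a\<in>A i - {a1 i, a2 i}. \<bar>c (a, i)\<bar>) \<le> (\<Sum>a\<in>A i. \<bar>c (a, i)\<bar>)"
      using finite_A by (intro sum_mono2) auto
    also have "\<dots> \<le> (\<Sum>i\<in>UNIV. \<Sum>a\<in>A i. \<bar>c (a, i)\<bar>)"
      by (intro member_le_sum) (auto intro: sum_nonneg)
    finally show "(\<Sum>a\<in>A i - {a1 i, a2 i}. \<bar>c (a, i)\<bar>) \<le> coeff_mass" by (simp add: coeff_mass_def)
  qed (use tail_bound(1) in simp)
  finally show ?thesis .
qed

lemma exists_reduced_root: "\<exists>v\<in>root_box. \<forall>i. reduced v i = 0"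
proof -
  have "\<exists>v\<in>root_box. \<forall>i. c (a1 i, i) + c (a2 i, i) * exp (v $ i)
      + (\<Sum>a\<in>A i - {a1 i, a2 i}. c (a, i) * weight v a i) = 0"
  proof (rule perturbed_binomial_root[OF opposite_signs _ root_box_def])
    show "root_center $ i = ln (- c (a1 i, i) / c (a2 i, i))" for i by (simp add: root_center_def)
    show "continuous_on root_box (\<lambda>v. \<Sum>a\<in>A i - {a1 i, a2 i}. c (a, i) * weight v a i)" for i
      unfolding weight_def
      by (intro continuous_intros continuous_on_sum bounded_linear.continuous_on[OF matrix_vector_mul_bounded_linear])
    show "\<bar>\<Sum>a\<in>A i - {a1 i, a2 i}. c (a, i) * weight v a i\<bar> \<le> \<bar>c (a1 i, i)\<bar> / 8"
      if "v \<in> root_box" for v i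
    proof -
      have "\<bar>\<Sum>a\<in>A i - {a1 i, a2 i}. c (a, i) * weight v a i\<bar>
          \<le> (\<Sum>a\<in>A i - {a1 i, a2 i}. \<bar>c (a, i)\<bar> * weight v a i)"
        by (rule order_trans[OF sum_abs]) (simp add: abs_mult weight_def)
      also have "\<dots> \<le> coeff_mass * tail_bound * 1" using tail_mass_le[OF that, of i] by simp
      also have "\<dots> \<le> coeff_mass * tail_bound * (1 + spread)"
        using spread_nonneg coeff_mass_pos tail_bound(1) by (intro mult_left_mono) auto
      also have "\<dots> \<le> \<bar>c (a1 i, i)\<bar> / 8" using tail_bound(4) min_coeff(2)[of i] by linarith
      finally show ?thesis .
    qed
  qed
  then show ?thesis by (simp add: reduced_eq)
qed

lemma pair_dominant_point:
  assumes "v \<in> root_box"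
  shows "pair_dominant A \<gamma> a1 a2 (point v)"
  unfolding pair_dominant_def
proof (intro allI ballI)
  fix i a assume a: "a \<in> A i - {a1 i, a2 i}"
  define base where "base = \<gamma> (a1 i, i) * monom (point v) (a1 i)"
  have "base > 0" using \<gamma>_pos[OF a1_in] monom_pos[OF point_pos] by (simp add: base_def)
  have T: "\<gamma> (b, i) * monom (point v) b = base * weight v b i" if "b \<in> A i" for b
    using term_eq_weight[OF that] by (simp add: base_def)
  have "\<bar>v $ i - root_center $ i\<bar> \<le> 1/4" using assms by (simp add: root_box_def)
  then have "exp (root_center $ i - 1/4) \<le> exp (v $ i)" unfolding exp_le_cancel_iff by arith
  then have "tail_bound < exp (v $ i)" using tail_bound(3) min_exp_box(2)[of i] by linarith
  moreover have "weight v a i \<le> tail_bound" using weight_off_pair_le[OF assms a] .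
  ultimately have "weight v a i < weight v (a1 i) i" "weight v a i < weight v (a2 i) i"
    using tail_bound(2) by (simp_all add: weight_a1 weight_a2)
  then show "\<gamma> (a, i) * monom (point v) a < \<gamma> (a1 i, i) * monom (point v) (a1 i) \<and>
             \<gamma> (a, i) * monom (point v) a < \<gamma> (a2 i, i) * monom (point v) (a2 i)"
    using \<open>base > 0\<close> a a1_in a2_in by (simp add: T)
qed

lemma cay_system_deriv_point:
  fixes v h :: "real^'d"
  assumes "reduced v i = 0"
  defines "\<zeta> \<equiv> pair_matrix a1 a2 *v (\<chi> j. h $ j / point v $ j)"
  shows "cay_system_deriv A c \<gamma> (point v) h $ i = \<gamma> (a1 i, i) * monom (point v) (a1 i) *
     (c (a2 i, i) * exp (v $ i) * \<zeta> $ i + (\<Sum>a\<in>A i - {a1 i, a2 i}.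
        c (a, i) * weight v a i * ((vec_of_int a - vec_of_int (a1 i)) \<bullet> (pair_inv *v \<zeta>))))"
proof -
  define \<eta> where "\<eta> = (\<chi> j. h $ j / point v $ j)"
  define base where "base = \<gamma> (a1 i, i) * monom (point v) (a1 i)"
  have \<eta>: "pair_inv *v \<zeta> = \<eta>" by (simp add: \<zeta>_def \<eta>_def matrix_vector_mul_assoc pair_inv_inverse)
  have \<zeta>_nth: "(vec_of_int (a2 i) - vec_of_int (a1 i)) \<bullet> \<eta> = \<zeta> $ i"
    by (simp add: \<zeta>_def \<eta>_def pair_matrix_mult_nth)
  have "cay_system_deriv A c \<gamma> (point v) h $ i
      = (\<Sum>a\<in>A i. c (a, i) * (\<gamma> (a, i) * monom (point v) a) * (vec_of_int a \<bullet> \<eta>))"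
    by (simp add: cay_system_deriv_def \<eta>_def mult.assoc)
  also have "\<dots> = base * (\<Sum>a\<in>A i. c (a, i) * weight v a i * (vec_of_int a \<bullet> \<eta>))"
    unfolding sum_distrib_left
    by (intro sum.cong refl) (simp add: term_eq_weight base_def mult_ac)
  also have "(\<Sum>a\<in>A i. c (a, i) * weight v a i * (vec_of_int a \<bullet> \<eta>))
      = (\<Sum>a\<in>A i. c (a, i) * weight v a i * ((vec_of_int a - vec_of_int (a1 i)) \<bullet> \<eta>))"
  proof -
    have "(\<Sum>a\<in>A i. c (a, i) * weight v a i * ((vec_of_int a - vec_of_int (a1 i)) \<bullet> \<eta>))
        = (\<Sum>a\<in>A i. c (a, i) * weight v a i * (vec_of_int a \<bullet> \<eta>)) - (vec_of_int (a1 i) \<bullet> \<eta>) * reduced v i"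
      by (simp add: reduced_def inner_diff_left algebra_simps sum_subtractf sum_distrib_left)
    then show ?thesis using assms(1) by simp
  qed
  also have "\<dots> = c (a2 i, i) * exp (v $ i) * ((vec_of_int (a2 i) - vec_of_int (a1 i)) \<bullet> \<eta>)
      + (\<Sum>a\<in>A i - {a1 i, a2 i}. c (a, i) * weight v a i * ((vec_of_int a - vec_of_int (a1 i)) \<bullet> \<eta>))"
    by (simp add: sum_split_pair[of _ i] weight_a1 weight_a2)
  finally show ?thesis unfolding base_def \<eta> \<zeta>_nth .
qed

lemma tail_inner_le:
  assumes "v \<in> root_box"
  shows "\<bar>\<Sum>a\<in>A i - {a1 i, a2 i}. c (a, i) * weight v a i * ((vec_of_int a - vec_of_int (a1 i)) \<bullet> (pair_inv *v z))\<bar>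
    \<le> min_coeff / 8 * infnorm z"
proof -
  have "\<bar>c (a, i) * weight v a i * ((vec_of_int a - vec_of_int (a1 i)) \<bullet> (pair_inv *v z))\<bar>
      \<le> \<bar>c (a, i)\<bar> * weight v a i * (spread * infnorm z)" if "a \<in> A i - {a1 i, a2 i}" for a
    using inner_pair_inv_le_spread[of a i z] that by (simp add: abs_mult weight_def mult_left_mono)
  then have "\<bar>\<Sum>a\<in>A i - {a1 i, a2 i}. c (a, i) * weight v a i * ((vec_of_int a - vec_of_int (a1 i)) \<bullet> (pair_inv *v z))\<bar>
      \<le> (\<Sum>a\<in>A i - {a1 i, a2 i}. \<bar>c (a, i)\<bar> * weight v a i) * (spread * infnorm z)"
    unfolding sum_distrib_right by (intro order_trans[OF sum_abs] sum_mono)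
  also have "\<dots> \<le> coeff_mass * tail_bound * (spread * infnorm z)"
    using tail_mass_le[OF assms, of i] spread_nonneg infnorm_pos_le[of z] by (intro mult_right_mono) auto
  also have "\<dots> \<le> coeff_mass * tail_bound * (1 + spread) * infnorm z"
    using coeff_mass_pos tail_bound(1) infnorm_pos_le[of z] by (simp add: mult_left_mono mult_right_mono)
  also have "\<dots> \<le> min_coeff / 8 * infnorm z"
    using tail_bound(4) infnorm_pos_le by (rule mult_right_mono)
  finally show ?thesis .
qed

lemma nondegenerate_point:
  assumes "v \<in> root_box" and root: "\<And>i. reduced v i = 0"
  shows "nondegenerate (cay_system A c \<gamma>) (point v)"
proof (rule nondegenerate_if_injective_derivative[OF has_derivative_cay_system[OF point_pos]])
  fix h assume h: "cay_system_deriv A c \<gamma> (point v) h = 0"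
  define \<zeta> where "\<zeta> = pair_matrix a1 a2 *v (\<chi> j. h $ j / point v $ j)"
  \<comment> \<open>in terms of \<open>\<zeta>\<close> the Jacobian is diagonal up to the small off-pair terms\<close>
  have "\<bar>\<zeta> $ i\<bar> \<le> 1/6 * infnorm \<zeta>" for i
  proof -
    define rest where "rest = (\<Sum>a\<in>A i - {a1 i, a2 i}.
        c (a, i) * weight v a i * ((vec_of_int a - vec_of_int (a1 i)) \<bullet> (pair_inv *v \<zeta>)))"
    define base where "base = \<gamma> (a1 i, i) * monom (point v) (a1 i)"
    have "base > 0" using \<gamma>_pos[OF a1_in] monom_pos[OF point_pos] by (simp add: base_def)
    moreover have "base * (c (a2 i, i) * exp (v $ i) * \<zeta> $ i + rest) = 0"
      using cay_system_deriv_point[of v i h, OF root] h unfolding \<zeta>_def rest_def base_def by simp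
    ultimately have "c (a2 i, i) * exp (v $ i) * \<zeta> $ i = - rest"
      by (simp add: add_eq_0_iff2)
    then have "3/4 * min_coeff * \<bar>\<zeta> $ i\<bar> \<le> \<bar>rest\<bar>"
      using mult_right_mono[OF abs_c2_exp_ge[OF assms(1), of i] abs_ge_zero[of "\<zeta> $ i"]]
      by (simp add: abs_mult)
    also have "\<dots> \<le> min_coeff / 8 * infnorm \<zeta>" unfolding rest_def by (rule tail_inner_le[OF assms(1)])
    finally have "min_coeff * (6 * \<bar>\<zeta> $ i\<bar>) \<le> min_coeff * infnorm \<zeta>" by simp
    then have "6 * \<bar>\<zeta> $ i\<bar> \<le> infnorm \<zeta>" using min_coeff(1) by (rule mult_left_le_imp_le)
    then show ?thesis by simp
  qed
  then have "\<zeta> = 0" by (rule zero_if_components_le_infnorm) simp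
  moreover have "pair_inv *v \<zeta> = (\<chi> j. h $ j / point v $ j)"
    by (simp add: \<zeta>_def matrix_vector_mul_assoc pair_inv_inverse)
  ultimately have "(\<chi> j. h $ j / point v $ j) = 0" by simp
  then have "h $ j / point v $ j = 0" for j by (simp add: vec_eq_iff)
  moreover have "point v $ j \<noteq> 0" for j using point_pos[of v j] by simp
  ultimately show "h = 0" by (simp add: vec_eq_iff)
qed

lemma exists_dominant_solution:
  "\<exists>x. (\<forall>k. x $ k > 0) \<and> cay_system A c \<gamma> x = 0 \<and>
       nondegenerate (cay_system A c \<gamma>) x \<and> pair_dominant A \<gamma> a1 a2 x"
proof -
  obtain v where "v \<in> root_box" "\<And>i. reduced v i = 0" using exists_reduced_root by blast
  then show ?thesis using point_pos nondegenerate_point pair_dominant_point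
    by (intro exI[of _ "point v"]) (simp add: vec_eq_iff cay_system_point)
qed

end

end

lemma (in decorated_pair) dominant_solution_of_cell_gap:
  assumes \<gamma>_pos: "\<forall>q\<in>cayley A. \<gamma> q > 0"
    and cell: "\<And>a i. (a, i) \<in> S \<longleftrightarrow> a = a1 i \<or> a = a2 i"
    and "cell_gap cay_emb (cayley A) S (\<lambda>q. - ln (\<gamma> q)) gap"
  shows "\<exists>x. (\<forall>k. x $ k > 0) \<and> cay_system A c \<gamma> x = 0 \<and>
             nondegenerate (cay_system A c \<gamma>) x \<and> pair_dominant A \<gamma> a1 a2 x"
proof -
  obtain u \<mu> where heights: "\<forall>q\<in>cayley A. (q \<in> S \<longrightarrow> inner u (cay_emb q) + \<mu> = - ln (\<gamma> q)) \<and>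
      (q \<notin> S \<longrightarrow> inner u (cay_emb q) + \<mu> + gap \<le> - ln (\<gamma> q))"
    using assms(3) unfolding cell_gap_def by blast
  show ?thesis
  proof (rule exists_dominant_solution[of \<gamma> "fst u" "\<lambda>i. snd u $ i + \<mu>"])
    show "\<gamma> (a, i) > 0" if "a \<in> A i" for a i using \<gamma>_pos that by (simp add: cayley_def)
    show "- ln (\<gamma> (a, i)) = vec_of_int a \<bullet> fst u + (snd u $ i + \<mu>)" if "a \<in> {a1 i, a2 i}" for a i
      using heights cell[of a i] that a1_in a2_in by (auto simp: cayley_def inner_cay_emb)
    show "vec_of_int a \<bullet> fst u + (snd u $ i + \<mu>) + gap \<le> - ln (\<gamma> (a, i))"
      if "a \<in> A i - {a1 i, a2 i}" for a i
    proof -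
      have "(a, i) \<in> cayley A" "(a, i) \<notin> S" using that cell[of a i] by (auto simp: cayley_def)
      then show ?thesis using heights by (fastforce simp: inner_cay_emb)
    qed
  qed
qed

section \<open>Distinct simplices give distinct solutions\<close>

lemma decorated_pair_of_mixed_simplex:
  assumes "\<And>i. finite (A i)" and "mixed_simplex A S" and "pos_decorated c S"
  obtains a1 a2 where "\<And>a i. (a, i) \<in> S \<longleftrightarrow> a = a1 i \<or> a = a2 i"
    and "decorated_pair A c a1 a2"
proof -
  obtain a1 a2 where ne: "\<And>i. a1 i \<noteq> a2 i" and S: "\<And>a i. (a, i) \<in> S \<longleftrightarrow> a = a1 i \<or> a = a2 i"
    using mixed_simplex_pairs[OF assms(2)] by blast
  have simplex: "cay_simplex A S" using assms(2) by (simp add: mixed_simplex_def)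
  show thesis
  proof (rule that[OF S], unfold_locales)
    show "a1 i \<in> A i" "a2 i \<in> A i" for i
      using simplex S[of "a1 i" i] S[of "a2 i" i] by (auto simp: cay_simplex_def cayley_def)
    have "(a1 i, i) \<in> S" "(a2 i, i) \<in> S" for i using S by auto
    then show "c (a1 i, i) * c (a2 i, i) < 0" for i
      using assms(3) ne[of i] unfolding pos_decorated_def by blast
    show "invertible (pair_matrix a1 a2)" by (rule invertible_pair_matrix[OF simplex S ne])
  qed (use assms(1) ne in auto)
qed

lemma decorated_pairs_of_mixed_simplices:
  assumes "\<And>i. finite (A i)"
    and "\<And>k. k < p \<Longrightarrow> mixed_simplex A (D k)" and "\<And>k. k < p \<Longrightarrow> pos_decorated c (D k)"
  shows "\<exists>a1 a2. (\<forall>k<p. \<forall>a i. (a, i) \<in> D k \<longleftrightarrow> a = a1 k i \<or> a = a2 k i) \<and>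
                 (\<forall>k<p. decorated_pair A c (a1 k) (a2 k))"
proof -
  have "\<exists>a1 a2. (\<forall>a i. (a, i) \<in> D k \<longleftrightarrow> a = a1 i \<or> a = a2 i) \<and> decorated_pair A c a1 a2"
    if "k < p" for k
    by (rule decorated_pair_of_mixed_simplex[OF assms(1) assms(2,3)[OF that]]) blast
  then show ?thesis by metis
qed

lemma inj_on_pair_dominant:
  assumes cells: "\<And>k a i. k < p \<Longrightarrow> (a, i) \<in> D k \<longleftrightarrow> a = a1 k i \<or> a = a2 k i"
    and decorated: "\<And>k. k < p \<Longrightarrow> decorated_pair A c (a1 k) (a2 k)"
    and "inj_on D {..<p}"
    and dominant: "\<And>k. k < p \<Longrightarrow> pair_dominant A \<gamma> (a1 k) (a2 k) (x k)"
  shows "inj_on x {..<p}"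
proof (rule inj_onI)
  fix k k' assume k: "k \<in> {..<p}" and k': "k' \<in> {..<p}" and "x k = x k'"
  have "{a1 k i, a2 k i} = {a1 k' i, a2 k' i}" for i
  proof (rule pair_dominant_same_pairs)
    show "pair_dominant A \<gamma> (a1 k) (a2 k) (x k)" using dominant k by simp
    show "pair_dominant A \<gamma> (a1 k') (a2 k') (x k)" using dominant k' \<open>x k = x k'\<close> by simp
    show "{a1 k i, a2 k i, a1 k' i, a2 k' i} \<subseteq> A i" "a1 k i \<noteq> a2 k i" "a1 k' i \<noteq> a2 k' i"
      using decorated[of k] decorated[of k'] k k' by (auto simp: decorated_pair_def)
  qed
  then have "D k = D k'" using cells k k' by (auto simp: set_eq_iff)
  then show "k = k'" using \<open>inj_on D {..<p}\<close> k k' by (auto dest: inj_onD)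
qed

lemma distinct_solutions_of_cell_gaps:
  assumes cells: "\<And>k a i. k < p \<Longrightarrow> (a, i) \<in> D k \<longleftrightarrow> a = a1 k i \<or> a = a2 k i"
    and pairs: "\<And>k. k < p \<Longrightarrow> decorated_pair A c (a1 k) (a2 k)"
    and "inj_on D {..<p}" and \<gamma>_pos: "\<forall>q\<in>cayley A. \<gamma> q > 0"
    and gaps: "\<And>k. k < p \<Longrightarrow>
      cell_gap cay_emb (cayley A) (D k) (\<lambda>q. - ln (\<gamma> q)) (decorated_pair.gap A c (a1 k) (a2 k))"
  shows "\<exists>X. finite X \<and> card X = p \<and>
           (\<forall>x\<in>X. (\<forall>k. x $ k > 0) \<and> cay_system A c \<gamma> x = 0 \<and> nondegenerate (cay_system A c \<gamma>) x)"
proof -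
  have "\<exists>x. (\<forall>j. x $ j > 0) \<and> cay_system A c \<gamma> x = 0 \<and> nondegenerate (cay_system A c \<gamma>) x \<and>
      pair_dominant A \<gamma> (a1 k) (a2 k) x" if "k < p" for k
    using decorated_pair.dominant_solution_of_cell_gap[OF pairs \<gamma>_pos cells gaps, OF that that that] .
  then obtain x where x: "\<And>k. k < p \<Longrightarrow> (\<forall>j. x k $ j > 0) \<and> cay_system A c \<gamma> (x k) = 0 \<and>
      nondegenerate (cay_system A c \<gamma>) (x k) \<and> pair_dominant A \<gamma> (a1 k) (a2 k) (x k)"
    by metis
  have "inj_on x {..<p}" using inj_on_pair_dominant[OF cells pairs \<open>inj_on D {..<p}\<close>] x by blast
  then show ?thesis using x by (intro exI[of _ "x ` {..<p}"]) (auto simp: card_image)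
qed

text \<open>The \<open>t\<^sub>0(\<epsilon>)\<close> of the theorem; the \<open>1\<close> inserted into the minimum only matters for \<open>l = 0\<close>.\<close>

definition height_threshold :: "real \<Rightarrow> nat \<Rightarrow> (nat \<Rightarrow> real) \<Rightarrow> real" where
  "height_threshold B l eps = exp (- ((B + 1) / Min (insert 1 (eps ` {..<l}))))"

lemma height_bound_of_prod_powr_le:
  fixes \<gamma> :: "'q \<Rightarrow> real" and m :: "nat \<Rightarrow> 'q \<Rightarrow> real" and eps :: "nat \<Rightarrow> real"
  assumes "finite P" and \<gamma>_pos: "\<forall>q\<in>P. \<gamma> q > 0" and eps_pos: "\<forall>r<l. 0 < eps r" and "0 \<le> B"
    and bound: "\<forall>r<l. (\<Prod>q\<in>P. \<gamma> q powr m r q) \<le> height_threshold B l eps powr eps r"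
  shows "\<forall>r<l. B < (\<Sum>q\<in>P. m r q * - ln (\<gamma> q))"
proof (intro allI impI)
  fix r assume r: "r < l"
  define e0 where "e0 = Min (insert 1 (eps ` {..<l}))"
  have e0: "0 < e0" "e0 \<le> eps r"
    using eps_pos r unfolding e0_def by (auto simp: Min_gr_iff intro: Min_le)
  have "(\<Prod>q\<in>P. \<gamma> q powr m r q) = exp (\<Sum>q\<in>P. m r q * ln (\<gamma> q))"
    using \<gamma>_pos \<open>finite P\<close> by (simp add: exp_sum powr_def) (rule prod.cong, auto)
  then have "exp (\<Sum>q\<in>P. m r q * ln (\<gamma> q)) \<le> exp (- (eps r * ((B + 1) / e0)))"
    using bound[rule_format, OF r] by (simp add: height_threshold_def powr_def e0_def)
  then have sum_le: "(\<Sum>q\<in>P. m r q * ln (\<gamma> q)) \<le> - (eps r * ((B + 1) / e0))" by simp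
  have "(B + 1) * e0 \<le> (B + 1) * eps r" using e0 \<open>0 \<le> B\<close> by (intro mult_left_mono) auto
  then have "B + 1 \<le> eps r * ((B + 1) / e0)" using e0(1) by (simp add: field_simps algebra_simps)
  then show "B < (\<Sum>q\<in>P. m r q * - ln (\<gamma> q))" using sum_le by (simp add: sum_negf)
qed

theorem theorem3p3:
  fixes A :: "'d::finite \<Rightarrow> (int^'d) set"
    and c :: "(int^'d) \<times> 'd \<Rightarrow> real"
    and p :: nat
    and Dl :: "nat \<Rightarrow> ((int^'d) \<times> 'd) set"
    and l :: nat
    and m :: "nat \<Rightarrow> ((int^'d) \<times> 'd \<Rightarrow> real)"
  assumes fin: "\<And>i. finite (A i)"
    and has_simplex: "\<exists>S. cay_simplex A S"
    and c_zero: "\<And>a i. a \<notin> A i \<Longrightarrow> c (a, i) = 0"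
    and distinct: "inj_on Dl {..<p}"
    and mixed: "\<And>k. k < p \<Longrightarrow> mixed_simplex A (Dl k)"
    and decorated: "\<And>k. k < p \<Longrightarrow> pos_decorated c (Dl k)"
    and common: "\<exists>h. \<forall>k<p. regular_cell cay_emb (cayley A) h (Dl k)"
    and cone: "\<And>h. (\<forall>k<p. regular_cell cay_emb (cayley A) h (Dl k)) \<longleftrightarrow>
                    (\<forall>r<l. (\<Sum>q\<in>cayley A. m r q * h q) > 0)"
  shows "\<exists>t0 :: (nat \<Rightarrow> real) \<Rightarrow> real.
           (\<forall>eps. (\<forall>r<l. 0 < eps r \<and> eps r < 1) \<longrightarrow> t0 eps > 0) \<and>
           (\<forall>\<gamma> :: (int^'d) \<times> 'd \<Rightarrow> real.
              (\<forall>q\<in>cayley A. \<gamma> q > 0) \<and>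
              (\<exists>eps. (\<forall>r<l. 0 < eps r \<and> eps r < 1) \<and>
                   (\<forall>r<l. (\<Prod>q\<in>cayley A. \<gamma> q powr m r q) \<le> t0 eps powr eps r))
              \<longrightarrow> (\<exists>X. finite X \<and> card X = p \<and>
                     (\<forall>x\<in>X. (\<forall>k. x $ k > 0) \<and> cay_system A c \<gamma> x = 0 \<and>
                             nondegenerate (cay_system A c \<gamma>) x)))"
proof -
  \<comment> \<open>\<open>has_simplex\<close> follows from \<open>mixed\<close> if \<open>p > 0\<close>; \<open>c_zero\<close> is irrelevant since \<open>cay_system\<close> sums over \<open>A i\<close>.\<close>
  obtain a1 a2 where cells: "\<forall>k<p. \<forall>a i. (a, i) \<in> Dl k \<longleftrightarrow> a = a1 k i \<or> a = a2 k i"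
    and pairs: "\<forall>k<p. decorated_pair A c (a1 k) (a2 k)"
    using decorated_pairs_of_mixed_simplices[where D = Dl and p = p, OF fin mixed decorated] by blast
  have "Dl k \<noteq> {}" if "k < p" for k using cells that by blast
  moreover have finC: "finite (cayley A)" using fin by (rule finite_cayley)
  ultimately obtain K where "K \<ge> 0" and K: "\<forall>M H. 0 \<le> M \<longrightarrow>
      (\<forall>r<l. K * M < (\<Sum>q\<in>cayley A. m r q * H q)) \<longrightarrow> (\<forall>k<p. cell_gap cay_emb (cayley A) (Dl k) H M)"
    using cell_gap_of_cone_height[OF finC _ cone common] by blast
  define M where "M = Max (insert 0 ((\<lambda>k. decorated_pair.gap A c (a1 k) (a2 k)) ` {..<p}))"
  have "0 \<le> M" and gap_le: "\<And>k. k < p \<Longrightarrow> decorated_pair.gap A c (a1 k) (a2 k) \<le> M"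
    unfolding M_def by (auto intro: Max_ge)
  show ?thesis
  proof (intro exI[of _ "height_threshold (K * M) l"] conjI allI impI; (elim conjE exE)?)
    fix \<gamma> eps
    assume \<gamma>_pos: "\<forall>q\<in>cayley A. \<gamma> q > 0" and eps: "\<forall>r<l. 0 < eps r \<and> eps r < 1"
      and bound: "\<forall>r<l. (\<Prod>q\<in>cayley A. \<gamma> q powr m r q) \<le> height_threshold (K * M) l eps powr eps r"
    have "\<forall>r<l. 0 < eps r" using eps by blast
    from height_bound_of_prod_powr_le[OF finC \<gamma>_pos this _ bound]
    have height_bound: "\<forall>r<l. K * M < (\<Sum>q\<in>cayley A. m r q * - ln (\<gamma> q))"
      using \<open>K \<ge> 0\<close> \<open>0 \<le> M\<close> by simp
    have "cell_gap cay_emb (cayley A) (Dl k) (\<lambda>q. - ln (\<gamma> q)) (decorated_pair.gap A c (a1 k) (a2 k))"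
      if "k < p" for k
      using K[rule_format, OF \<open>0 \<le> M\<close> height_bound[rule_format] that] gap_le[OF that]
      by (rule cell_gap_mono)
    then show "\<exists>X. finite X \<and> card X = p \<and> (\<forall>x\<in>X. (\<forall>k. x $ k > 0) \<and> cay_system A c \<gamma> x = 0 \<and>
        nondegenerate (cay_system A c \<gamma>) x)"
      using distinct_solutions_of_cell_gaps[OF cells[rule_format] pairs[rule_format] distinct \<gamma>_pos]
      by blast
  qed (simp add: height_threshold_def)
qed

end
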